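(* Let $\mathcal{S}$ be an addable abstract numeration system, let $\mathbf{x}$ be an $\mathcal{S}$-automatic infinite word over a finite alphabet, and let $X$ be the subshift generated by $\mathbf{x}$. Then the winning shift $W(X)$ is weakly $\mathcal{S}$-codable.
   Context: Subshifts are one-sided: closed shift-invariant subsets of $A^{\mathbb{N}}$; the subshift generated by $\mathbf{x}$ is its orbit closure. Winning shift: for $X\subseteq A^{\mathbb{N}}$ and a choice sequence $\alpha=\alpha_0\alpha_1\cdots\in\{0,\dots,|A|-1\}^{\mathbb{N}}$, Alice and Bob play infinitely many rounds; in round $j$ Alice chooses $A_j\subseteq A$ with $|A_j|=\alpha_j+1$ and Bob chooses $a_j\in A_j$; Alice wins if $a_0a_1\cdots\in X$. $W(X)$ is the set of $\alpha$ for which Alice has a winning strategy (a subset of $\mathbb{N}^{\mathbb{N}}$). ANS: $\mathcal{S}=(L,\prec)$ with $L$ an infinite language and $\prec$ a total order on $L$ of order type $\omega$; $\mathrm{rep}(n)$ is the $n$-th word of $L$, $\mathrm{val}=\mathrm{rep}^{-1}$; tuples in $\mathbb{N}^d$ are represented by left-padding the component representations with a new symbol $\#$ to equal length. $Y\subseteq\mathbb{N}^d$ is $\mathcal{S}$-recognizable if $\mathrm{rep}(Y)$ is regular. $\mathcal{S}$ is addable if $\{(x,y,x+y)\}$ is $\mathcal{S}$-recognizable. $\mathbf{x}$ is $\mathcal{S}$-automatic if some DFA with output outputs $\mathbf{x}[n]$ on input $\mathrm{rep}(n)$ for all $n\ge0$. Codability: for $\mathbf{y}\in\mathbb{N}^{\mathbb{N}}$,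 $\sum\mathbf{y}=\sum_iy_i$; if $\sum\mathbf{y}=d<\infty$, $\nu(\mathbf{y})$ is the unique nondecreasing $(n_1,\dots,n_d)$ with $y_j=|\{k:n_k=j\}|$ for all $j$. $Y\subseteq\mathbb{N}^{\mathbb{N}}$ is weakly $\mathcal{S}$-codable if for each $k\in\mathbb{N}$ the set $\{\nu(\mathbf{y}):\mathbf{y}\in Y,\sum\mathbf{y}\le k\}$ is $\mathcal{S}$-recognizable (i.e. its intersection with each $\mathbb{N}^i$, $i\le k$, is). *)

theory Defs
  imports Main "HOL-Library.Multiset" "HOL-Library.Extended_Nat"
begin

definition regular :: "'b set \<Rightarrow> 'b list set \<Rightarrow> bool" where
  "regular \<Sigma> K \<longleftrightarrow> K \<subseteq> lists \<Sigma> \<and>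
     (\<exists>(Q::nat set) q0 \<delta> F. finite Q \<and> q0 \<in> Q \<and> (\<forall>q\<in>Q. \<forall>a\<in>\<Sigma>. \<delta> q a \<in> Q) \<and> F \<subseteq> Q \<and>
        K = {w \<in> lists \<Sigma>. foldl \<delta> q0 w \<in> F})"

text \<open>An ANS over the finite alphabet Sigma: an infinite language L over Sigma with a
  strict total order on L of order type omega (every word has finitely many predecessors).\<close>
definition ANS :: "'a set \<Rightarrow> 'a list set \<Rightarrow> ('a list \<Rightarrow> 'a list \<Rightarrow> bool) \<Rightarrow> bool" where
  "ANS \<Sigma> L prec \<longleftrightarrow> finite \<Sigma> \<and> L \<subseteq> lists \<Sigma> \<and> infinite L \<and>
     (\<forall>u\<in>L. \<not> prec u u) \<and>
     (\<forall>u\<in>L. \<forall>v\<in>L. \<forall>w\<in>L. prec u v \<longrightarrow> prec v w \<longrightarrow> prec u w) \<and>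
     (\<forall>u\<in>L. \<forall>v\<in>L. u \<noteq> v \<longrightarrow> prec u v \<or> prec v u) \<and>
     (\<forall>w\<in>L. finite {v\<in>L. prec v w})"

definition rep :: "'a list set \<Rightarrow> ('a list \<Rightarrow> 'a list \<Rightarrow> bool) \<Rightarrow> nat \<Rightarrow> 'a list" where
  "rep L prec n = (THE w. w \<in> L \<and> card {v\<in>L. prec v w} = n)"

text \<open>Padding with the new symbol # (rendered as None).\<close>
definition pad :: "nat \<Rightarrow> 'a list \<Rightarrow> 'a option list" where
  "pad m w = replicate (m - length w) None @ map Some w"

definition rep_tuple :: "'a list set \<Rightarrow> ('a list \<Rightarrow> 'a list \<Rightarrow> bool) \<Rightarrow> nat list \<Rightarrow> 'a option list list" where
  "rep_tuple L prec ns =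
     (let ws = map (rep L prec) ns; m = foldr max (map length ws) 0
      in map (\<lambda>i. map (\<lambda>w. pad m w ! i) ws) [0..<m])"

definition tuple_alph :: "'a set \<Rightarrow> nat \<Rightarrow> 'a option list set" where
  "tuple_alph \<Sigma> d = {c. length c = d \<and> set c \<subseteq> Some ` \<Sigma> \<union> {None}}"

definition recognizable ::
  "'a set \<Rightarrow> 'a list set \<Rightarrow> ('a list \<Rightarrow> 'a list \<Rightarrow> bool) \<Rightarrow> nat \<Rightarrow> nat list set \<Rightarrow> bool" where
  "recognizable \<Sigma> L prec d Y \<longleftrightarrow> Y \<subseteq> {ns. length ns = d} \<and>
     regular (tuple_alph \<Sigma> d) (rep_tuple L prec ` Y)"

definition addable :: "'a set \<Rightarrow> 'a list set \<Rightarrow> ('a list \<Rightarrow> 'a list \<Rightarrow> bool) \<Rightarrow> bool" where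
  "addable \<Sigma> L prec \<longleftrightarrow> recognizable \<Sigma> L prec 3 {[x, y, x + y] | x y. True}"

definition automatic ::
  "'a set \<Rightarrow> 'a list set \<Rightarrow> ('a list \<Rightarrow> 'a list \<Rightarrow> bool) \<Rightarrow> (nat \<Rightarrow> 'b) \<Rightarrow> bool" where
  "automatic \<Sigma> L prec x \<longleftrightarrow>
     (\<exists>(Q::nat set) q0 \<delta> (\<tau>::nat \<Rightarrow> 'b). finite Q \<and> q0 \<in> Q \<and> (\<forall>q\<in>Q. \<forall>a\<in>\<Sigma>. \<delta> q a \<in> Q) \<and>
        (\<forall>n. x n = \<tau> (foldl \<delta> q0 (rep L prec n))))"

text \<open>Orbit closure of x in A^N (product of discrete topologies): y lies in it iff every
  prefix of y occurs in x.\<close>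
definition subshift_gen :: "'b set \<Rightarrow> (nat \<Rightarrow> 'b) \<Rightarrow> (nat \<Rightarrow> 'b) set" where
  "subshift_gen A x = {y. (\<forall>n. y n \<in> A) \<and> (\<forall>n. \<exists>k. \<forall>i<n. y i = x (k + i))}"

text \<open>Alice's strategy maps the history of Bob's moves a_0...a_{j-1} to the set A_j.\<close>
definition winning_shift :: "'b set \<Rightarrow> (nat \<Rightarrow> 'b) set \<Rightarrow> (nat \<Rightarrow> nat) set" where
  "winning_shift A X = {\<alpha>. (\<forall>j. \<alpha> j < card A) \<and>
     (\<exists>\<sigma> :: 'b list \<Rightarrow> 'b set.
        (\<forall>h. \<sigma> h \<subseteq> A \<and> card (\<sigma> h) = \<alpha> (length h) + 1) \<and>
        (\<forall>b. (\<forall>j. b j \<in> \<sigma> (map b [0..<j])) \<longrightarrow> b \<in> X))}"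

definition seq_sum :: "(nat \<Rightarrow> nat) \<Rightarrow> enat" where
  "seq_sum y = (if finite {j. y j \<noteq> 0} then enat (\<Sum>j\<in>{j. y j \<noteq> 0}. y j) else \<infinity>)"

definition nu :: "(nat \<Rightarrow> nat) \<Rightarrow> nat list" where
  "nu y = (THE ns. sorted ns \<and> (\<forall>j. count (mset ns) j = y j))"

definition weakly_codable ::
  "'a set \<Rightarrow> 'a list set \<Rightarrow> ('a list \<Rightarrow> 'a list \<Rightarrow> bool) \<Rightarrow> (nat \<Rightarrow> nat) set \<Rightarrow> bool" where
  "weakly_codable \<Sigma> L prec Y \<longleftrightarrow>
     (\<forall>k i. i \<le> k \<longrightarrow>
        recognizable \<Sigma> L prec i ({nu y | y. y \<in> Y \<and> seq_sum y \<le> enat k} \<inter> {ns. length ns = i}))"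

end

theory Submission
  imports Defs "HOL-Library.Omega_Words_Fun"
begin

text \<open>If Alice wins for a choice sequence of finite sum \<open>d\<close>, her strategy is a tree with at most
  \<open>2 ^ d\<close> branches. Up to the last real choice each branch is a factor of the word, and from then
  on it may be continued as in the word. So the strategy is encoded by at most \<open>2 ^ d\<close> positions,
  and winning is expressed by a first-order formula over addition and the letters of the word.
  Predicates defined by such formulas are recognizable, because having finitely many residuals
  is preserved by Boolean operations, by renaming of variables and by projection.\<close>

section \<open>Languages with finitely many residuals\<close>

definition residual :: "'c list set \<Rightarrow> 'c list \<Rightarrow> 'c list set" where
  "residual K u = {v. u @ v \<in> K}"

definition finite_residuals :: "'c list set \<Rightarrow> bool" where
  "finite_residuals K \<longleftrightarrow> finite (range (residual K))"

lemma residual_Nil: "residual K [] = K"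
  by (simp add: residual_def)

lemma Nil_in_residual_iff: "[] \<in> residual K u \<longleftrightarrow> u \<in> K"
  by (simp add: residual_def)

lemma residual_append: "residual K (u @ v) = residual (residual K u) v"
  by (simp add: residual_def)

lemma finite_residualsI:
  assumes "finite S" and "\<And>u. residual K u \<in> S"
  shows "finite_residuals K"
  unfolding finite_residuals_def using assms by (meson finite_subset image_subsetI)

lemma finite_residuals_Compl:
  assumes "finite_residuals K"
  shows "finite_residuals (- K)"
proof (rule finite_residualsI)
  show "finite (uminus ` range (residual K))"
    using assms by (simp add: finite_residuals_def)
  have "residual (- K) u = - residual K u" for u
    by (auto simp: residual_def)
  then show "residual (- K) u \<in> uminus ` range (residual K)" for u
    by blast
qed

lemma finite_residuals_Int:
  assumes "finite_residuals K" and "finite_residuals K'"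
  shows "finite_residuals (K \<inter> K')"
proof (rule finite_residualsI)
  let ?S = "(\<lambda>(R, R'). R \<inter> R') ` (range (residual K) \<times> range (residual K'))"
  show "finite ?S"
    using assms unfolding finite_residuals_def by blast
  have "residual (K \<inter> K') u = residual K u \<inter> residual K' u" for u
    by (auto simp: residual_def)
  then show "residual (K \<inter> K') u \<in> ?S" for u
    by auto
qed

lemma finite_residuals_UNIV: "finite_residuals UNIV"
  by (rule finite_residualsI[of "{UNIV}"]) (auto simp: residual_def)

lemma finite_residuals_empty: "finite_residuals {}"
  using finite_residuals_Compl[OF finite_residuals_UNIV] by simp

lemma finite_residuals_INT:
  assumes "finite I" and "\<And>i. i \<in> I \<Longrightarrow> finite_residuals (K i)"
  shows "finite_residuals (\<Inter>i\<in>I. K i)"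
  using assms by (induction I) (auto simp: finite_residuals_UNIV intro: finite_residuals_Int)

lemma finite_residuals_lists: "finite_residuals (lists \<Sigma>)"
  by (rule finite_residualsI[of "{lists \<Sigma>, {}}"]) (auto simp: residual_def)

lemma finite_residuals_hd_neq: "finite_residuals {w. w = [] \<or> hd w \<noteq> c}"
proof (rule finite_residualsI)
  show "residual {w. w = [] \<or> hd w \<noteq> c} u \<in> {{w. w = [] \<or> hd w \<noteq> c}, UNIV, {}}" for u
    by (cases u) (auto simp: residual_def)
qed simp

lemma finite_residuals_vimage_map:
  assumes "finite_residuals K"
  shows "finite_residuals (map h -` K)"
proof (rule finite_residualsI)
  show "finite ((\<lambda>R. map h -` R) ` range (residual K))"
    using assms by (simp add: finite_residuals_def)
  have "residual (map h -` K) u = map h -` residual K (map h u)" for u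
    by (auto simp: residual_def)
  then show "residual (map h -` K) u \<in> (\<lambda>R. map h -` R) ` range (residual K)" for u
    by blast
qed

lemma finite_residuals_image_map:
  assumes "finite_residuals K"
  shows "finite_residuals (map h ` K)"
proof (rule finite_residualsI)
  let ?S = "(\<lambda>\<R>. map h ` \<Union>\<R>) ` Pow (range (residual K))"
  show "finite ?S"
    using assms by (simp add: finite_residuals_def)
  have "residual (map h ` K) u = map h ` \<Union>(residual K ` {u'. map h u' = u})" for u
  proof (intro equalityI subsetI)
    fix v assume "v \<in> residual (map h ` K) u"
    then obtain w where w: "w \<in> K" "u @ v = map h w"
      by (auto simp: residual_def)
    then obtain u' v' where "w = u' @ v'" "map h u' = u" "map h v' = v"
      by (metis append_eq_map_conv)
    with w(1) show "v \<in> map h ` \<Union>(residual K ` {u'. map h u' = u})"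
      by (auto simp: residual_def)
  next
    fix v assume "v \<in> map h ` \<Union>(residual K ` {u'. map h u' = u})"
    then obtain u' v' where "map h u' = u" "map h v' = v" "u' @ v' \<in> K"
      by (auto simp: residual_def)
    then show "v \<in> residual (map h ` K) u"
      by (auto simp: residual_def intro!: image_eqI[of _ _ "u' @ v'"])
  qed
  then show "residual (map h ` K) u \<in> ?S" for u
    by blast
qed

definition left_stripping :: "'c \<Rightarrow> 'c list set \<Rightarrow> 'c list set" where
  "left_stripping c K = {w. \<exists>k. replicate k c @ w \<in> K}"

lemma finite_residuals_left_stripping:
  assumes "finite_residuals K"
  shows "finite_residuals (left_stripping c K)"
proof (rule finite_residualsI)
  show "finite (Union ` Pow (range (residual K)))"
    using assms by (simp add: finite_residuals_def)
  have "residual (left_stripping c K) u = \<Union>(range (\<lambda>k. residual K (replicate k c @ u)))" for u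
    by (auto simp: residual_def left_stripping_def)
  then show "residual (left_stripping c K) u \<in> Union ` Pow (range (residual K))" for u
    by blast
qed

inductive_set left_padding :: "'c \<Rightarrow> 'c list set \<Rightarrow> 'c list set" for c K where
  base: "w \<in> K \<Longrightarrow> w \<in> left_padding c K"
| pad: "w \<in> left_padding c K \<Longrightarrow> c # w \<in> left_padding c K"

lemma left_padding_eq: "left_padding c K = {replicate k c @ w | k w. w \<in> K}"
proof (intro equalityI subsetI)
  fix u assume "u \<in> left_padding c K"
  then have "\<exists>k w. u = replicate k c @ w \<and> w \<in> K"
  proof induction
    case (base w)
    then show ?case by (metis append_Nil replicate_0)
  next
    case (pad u)
    then show ?case by (metis append_Cons replicate_Suc)
  qed
  then show "u \<in> {replicate k c @ w | k w. w \<in> K}" by blast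
next
  fix u assume "u \<in> {replicate k c @ w | k w. w \<in> K}"
  then obtain k w where "u = replicate k c @ w" "w \<in> K" by blast
  then show "u \<in> left_padding c K"
    by (induction k arbitrary: u) (auto intro: left_padding.intros)
qed

lemma Cons_in_left_padding_iff:
  "a # w \<in> left_padding c K \<longleftrightarrow> a # w \<in> K \<or> a = c \<and> w \<in> left_padding c K"
  by (subst left_padding.simps) auto

lemma residual_left_padding_Cons:
  "residual (left_padding c K) (a # u)
    = residual K (a # u) \<union> (if a = c then residual (left_padding c K) u else {})"
  by (auto simp: residual_def Cons_in_left_padding_iff)

lemma finite_residuals_left_padding:
  assumes "finite_residuals K"
  shows "finite_residuals (left_padding c K)"
proof (rule finite_residualsI)
  let ?S = "(\<lambda>(T, \<R>). T \<union> \<Union>\<R>) ` ({left_padding c K, {}} \<times> Pow (range (residual K)))"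
  show "finite ?S"
    using assms by (simp add: finite_residuals_def)
  have union_in_S: "T \<union> \<Union>\<R> \<in> ?S" if "T \<in> {left_padding c K, {}}" "\<R> \<subseteq> range (residual K)" for T \<R>
    using that by auto
  show "residual (left_padding c K) u \<in> ?S" for u
  proof (induction u)
    case Nil
    then show ?case using union_in_S[of "left_padding c K" "{}"] by (simp add: residual_Nil)
  next
    case (Cons a u)
    then obtain T \<R> where T: "T \<in> {left_padding c K, {}}" and \<R>: "\<R> \<subseteq> range (residual K)"
      and u: "residual (left_padding c K) u = T \<union> \<Union>\<R>"
      by auto
    show ?case
    proof (cases "a = c")
      case True
      then have "residual (left_padding c K) (a # u) = T \<union> \<Union>(insert (residual K (a # u)) \<R>)"
        using u by (auto simp: residual_left_padding_Cons)
      then show ?thesis using union_in_S[OF T, of "insert (residual K (a # u)) \<R>"] \<R> by simp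
    next
      case False
      then show ?thesis
        using union_in_S[of "{}" "{residual K (a # u)}"] by (simp add: residual_left_padding_Cons)
    qed
  qed
qed

lemma left_padding_Int_hd_neq:
  assumes "\<And>w. w \<in> K \<Longrightarrow> w = [] \<or> hd w \<noteq> c"
  shows "left_padding c K \<inter> {w. w = [] \<or> hd w \<noteq> c} = K"
  using assms by (auto intro: left_padding.base elim: left_padding.cases)

lemma foldl_closed:
  assumes "\<forall>q\<in>Q. \<forall>a\<in>\<Sigma>. \<delta> q a \<in> Q" and "q \<in> Q" and "w \<in> lists \<Sigma>"
  shows "foldl \<delta> q w \<in> Q"
  using assms by (induction w arbitrary: q) auto

lemma finite_residuals_automaton:
  assumes "finite Q" and "q0 \<in> Q" and "\<forall>q\<in>Q. \<forall>a\<in>\<Sigma>. \<delta> q a \<in> Q"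
  shows "finite_residuals {w \<in> lists \<Sigma>. P (foldl \<delta> q0 w)}"
proof (rule finite_residualsI)
  let ?S = "insert {} ((\<lambda>q. {v \<in> lists \<Sigma>. P (foldl \<delta> q v)}) ` Q)"
  show "finite ?S" using assms(1) by simp
  show "residual {w \<in> lists \<Sigma>. P (foldl \<delta> q0 w)} u \<in> ?S" for u
  proof (cases "u \<in> lists \<Sigma>")
    case True
    then have "residual {w \<in> lists \<Sigma>. P (foldl \<delta> q0 w)} u
        = {v \<in> lists \<Sigma>. P (foldl \<delta> (foldl \<delta> q0 u) v)}"
      by (auto simp: residual_def)
    moreover have "foldl \<delta> q0 u \<in> Q"
      using True foldl_closed assms by metis
    ultimately show ?thesis by blast
  qed (auto simp: residual_def)
qed

lemma regular_imp_finite_residuals: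
  assumes "regular \<Sigma> K"
  shows "finite_residuals K"
proof -
  obtain Q :: "nat set" and q0 \<delta> F
    where Q: "finite Q" "q0 \<in> Q" "\<forall>q\<in>Q. \<forall>a\<in>\<Sigma>. \<delta> q a \<in> Q"
      and K: "K = {w \<in> lists \<Sigma>. foldl \<delta> q0 w \<in> F}"
    using assms unfolding regular_def by blast
  show ?thesis
    unfolding K by (rule finite_residuals_automaton[OF Q])
qed

lemma finite_residuals_imp_regular:
  assumes "finite_residuals K" and "K \<subseteq> lists \<Sigma>"
  shows "regular \<Sigma> K"
proof -
  let ?R = "range (residual K)"
  have "finite ?R" using assms(1) unfolding finite_residuals_def .
  then obtain code :: "'a list set \<Rightarrow> nat" where code: "inj_on code ?R"
    using finite_imp_inj_to_nat_seg by metis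
  define decode where "decode = inv_into ?R code"
  have decode [simp]: "decode (code (residual K u)) = residual K u" for u
    unfolding decode_def using code by simp
  define \<delta> where "\<delta> q a = code (residual (decode q) [a])" for q a
  let ?Q = "code ` ?R" and ?F = "{q \<in> code ` ?R. [] \<in> decode q}"
  have delta_code: "\<delta> (code (residual K u)) a = code (residual K (u @ [a]))" for u a
    by (simp add: \<delta>_def residual_append)
  have foldl_code: "foldl \<delta> (code (residual K [])) w = code (residual K w)" for w
    by (induction w rule: rev_induct) (simp_all add: delta_code)
  show ?thesis
    unfolding regular_def
  proof (intro conjI exI)
    show "finite ?Q" using \<open>finite ?R\<close> by simp
    show "code (residual K []) \<in> ?Q" by blast
    show "\<forall>q\<in>?Q. \<forall>a\<in>\<Sigma>. \<delta> q a \<in> ?Q" by (auto simp: delta_code)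
    show "?F \<subseteq> ?Q" by blast
    show "K = {w \<in> lists \<Sigma>. foldl \<delta> (code (residual K [])) w \<in> ?F}"
      unfolding foldl_code using assms(2) by (auto simp: Nil_in_residual_iff)
  qed (rule assms(2))
qed

theorem regular_iff_finite_residuals:
  "regular \<Sigma> K \<longleftrightarrow> K \<subseteq> lists \<Sigma> \<and> finite_residuals K"
proof
  assume "regular \<Sigma> K"
  moreover from this have "K \<subseteq> lists \<Sigma>" by (simp add: regular_def)
  ultimately show "K \<subseteq> lists \<Sigma> \<and> finite_residuals K"
    by (simp add: regular_imp_finite_residuals)
qed (simp add: finite_residuals_imp_regular)

section \<open>Padded representations\<close>

lemma length_pad [simp]: "length w \<le> m \<Longrightarrow> length (pad m w) = m"
  by (simp add: pad_def)

lemma pad_add: "length w \<le> m \<Longrightarrow> pad (k + m) w = replicate k None @ pad m w"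
  by (simp add: pad_def flip: replicate_add)

lemma filter_pad: "filter (\<lambda>z. z \<noteq> None) (pad m w) = map Some w"
  by (simp add: pad_def filter_replicate)

lemma pad_nth_None: "length w \<le> m \<Longrightarrow> 0 < m \<Longrightarrow> pad m w ! 0 = None \<Longrightarrow> length w \<le> m - 1"
  by (cases "length w = m") (auto simp: pad_def nth_append)

definition padded :: "(nat \<Rightarrow> 'a list) \<Rightarrow> nat set \<Rightarrow> 'a option list set" where
  "padded r N = {pad m (r n) | m n. n \<in> N \<and> length (r n) \<le> m}"

lemma pad_in_paddedI: "n \<in> N \<Longrightarrow> length (r n) \<le> m \<Longrightarrow> pad m (r n) \<in> padded r N"
  unfolding padded_def by blast

lemma paddedE:
  assumes "w \<in> padded r N"
  obtains n where "n \<in> N" and "w = pad (length w) (r n)" and "length (r n) \<le> length w"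
  using assms unfolding padded_def by auto

lemma pad_in_padded_iff:
  assumes "inj r" and "length (r n) \<le> m"
  shows "pad m (r n) \<in> padded r N \<longleftrightarrow> n \<in> N"
proof
  assume "pad m (r n) \<in> padded r N"
  then obtain m' n' where n': "n' \<in> N" "pad m (r n) = pad m' (r n')"
    unfolding padded_def by auto
  then have "map Some (r n) = map Some (r n')"
    by (metis filter_pad)
  with n'(1) assms(1) show "n \<in> N" by (simp add: inj_eq)
qed (simp add: pad_in_paddedI assms(2))

lemma padded_eq_left_padding: "padded r N = left_padding None (map Some ` r ` N)"
proof (intro equalityI subsetI)
  fix w assume "w \<in> left_padding None (map Some ` r ` N)"
  then obtain k n where "n \<in> N" "w = replicate k None @ map Some (r n)"
    by (auto simp: left_padding_eq)
  then have "n \<in> N" "w = pad (k + length (r n)) (r n)"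
    by (simp_all add: pad_def)
  then show "w \<in> padded r N"
    unfolding padded_def by (metis (mono_tags, lifting) CollectI le_add2)
qed (auto simp: padded_def pad_def left_padding_eq)

lemma left_stripping_padded: "left_stripping None (padded r N) = padded r N"
proof -
  have "w \<in> padded r N" if "replicate k None @ w \<in> padded r N" for k w
    using that by (induction k) (auto simp: padded_eq_left_padding Cons_in_left_padding_iff)
  then show ?thesis
    unfolding left_stripping_def by (auto intro: exI[of _ 0])
qed

lemma finite_residuals_padded_vimage:
  assumes "finite_residuals K" and "finite_residuals (padded r UNIV)"
  shows "finite_residuals (padded r (r -` K))"
proof -
  have "padded r (r -` K) = left_padding None (map Some ` K) \<inter> padded r UNIV"
  proof (intro equalityI subsetI)
    fix w assume w: "w \<in> left_padding None (map Some ` K) \<inter> padded r UNIV"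
    then obtain k u where u: "u \<in> K" "w = replicate k None @ map Some u"
      by (auto simp: left_padding_eq)
    from w obtain m n where n: "w = pad m (r n)" "length (r n) \<le> m"
      unfolding padded_def by auto
    have "map Some u = filter (\<lambda>z. z \<noteq> None) w"
      unfolding u(2) by (simp add: filter_replicate)
    also have "\<dots> = map Some (r n)"
      unfolding n(1) by (rule filter_pad)
    finally show "w \<in> padded r (r -` K)"
      using u(1) n unfolding padded_def by auto
  qed (auto simp: padded_eq_left_padding left_padding_eq)
  then show ?thesis
    using assms
    by (simp add: finite_residuals_Int finite_residuals_left_padding finite_residuals_image_map)
qed

definition tuple_word :: "(nat \<Rightarrow> 'a list) \<Rightarrow> nat \<Rightarrow> nat list \<Rightarrow> 'a option list list" where
  "tuple_word r m ns = map (\<lambda>j. map (\<lambda>n. pad m (r n) ! j) ns) [0..<m]"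

definition max_length :: "(nat \<Rightarrow> 'a list) \<Rightarrow> nat list \<Rightarrow> nat" where
  "max_length r ns = foldr max (map (\<lambda>n. length (r n)) ns) 0"

definition padded_tuples :: "(nat \<Rightarrow> 'a list) \<Rightarrow> nat list set \<Rightarrow> 'a option list list set" where
  "padded_tuples r Y = {tuple_word r m ns | m ns. ns \<in> Y \<and> max_length r ns \<le> m}"

lemma max_length_le_iff: "max_length r ns \<le> m \<longleftrightarrow> (\<forall>n\<in>set ns. length (r n) \<le> m)"
  unfolding max_length_def by (induction ns) auto

lemma length_le_max_length: "n \<in> set ns \<Longrightarrow> length (r n) \<le> max_length r ns"
  using max_length_le_iff by blast

lemma rep_tuple_eq_tuple_word:
  "rep_tuple L prec ns = tuple_word (rep L prec) (max_length (rep L prec) ns) ns"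
  by (simp add: rep_tuple_def tuple_word_def max_length_def Let_def comp_def)

lemma length_tuple_word [simp]: "length (tuple_word r m ns) = m"
  by (simp add: tuple_word_def)

lemma length_in_tuple_word: "c \<in> set (tuple_word r m ns) \<Longrightarrow> length c = length ns"
  by (auto simp: tuple_word_def)

lemma row_tuple_word:
  assumes "i < length ns" and "max_length r ns \<le> m"
  shows "map (\<lambda>c. c ! i) (tuple_word r m ns) = pad m (r (ns ! i))"
  using assms by (auto simp: tuple_word_def max_length_le_iff intro!: nth_equalityI)

lemma tuple_word_eqI:
  assumes "max_length r ns \<le> length w" and "\<And>c. c \<in> set w \<Longrightarrow> length c = length ns"
    and "\<And>i. i < length ns \<Longrightarrow> map (\<lambda>c. c ! i) w = pad (length w) (r (ns ! i))"
  shows "w = tuple_word r (length w) ns"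
proof (rule nth_equalityI)
  fix j assume j: "j < length w"
  show "w ! j = tuple_word r (length w) ns ! j"
  proof (rule nth_equalityI)
    show "length (w ! j) = length (tuple_word r (length w) ns ! j)"
      using assms(2) j by (simp add: tuple_word_def)
    fix i assume "i < length (w ! j)"
    then have i: "i < length ns" using assms(2) j by simp
    have "w ! j ! i = map (\<lambda>c. c ! i) w ! j" using j by simp
    also have "\<dots> = tuple_word r (length w) ns ! j ! i"
      unfolding assms(3)[OF i] using i j by (simp add: tuple_word_def)
    finally show "w ! j ! i = tuple_word r (length w) ns ! j ! i" .
  qed
qed simp

lemma tuple_word_add:
  assumes "max_length r ns \<le> m"
  shows "tuple_word r (k + m) ns = replicate k (replicate (length ns) None) @ tuple_word r m ns"
    (is "_ = ?w")
proof -
  have "?w = tuple_word r (length ?w) ns"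
  proof (rule tuple_word_eqI)
    show "length c = length ns" if "c \<in> set ?w" for c
      using that by (auto dest: length_in_tuple_word split: if_splits)
    show "map (\<lambda>c. c ! i) ?w = pad (length ?w) (r (ns ! i))" if "i < length ns" for i
      using that assms by (simp add: row_tuple_word pad_add max_length_le_iff)
  qed (use assms in simp)
  then show ?thesis by simp
qed

lemma tuple_word_inj:
  assumes "inj r" and "length ns = length ns'" and "max_length r ns \<le> m"
    and "max_length r ns' \<le> m" and "tuple_word r m ns = tuple_word r m ns'"
  shows "ns = ns'"
proof (rule nth_equalityI)
  fix i assume i: "i < length ns"
  have "pad m (r (ns ! i)) = map (\<lambda>c. c ! i) (tuple_word r m ns)"
    using i assms(3) by (simp add: row_tuple_word)
  also have "\<dots> = pad m (r (ns' ! i))"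
    unfolding assms(5) using i assms(2,4) by (simp add: row_tuple_word)
  finally have "map Some (r (ns ! i)) = map Some (r (ns' ! i))"
    by (metis filter_pad)
  then show "ns ! i = ns' ! i" using assms(1) by (simp add: inj_eq)
qed (rule assms(2))

lemma tuple_word_in_padded_tuples_iff:
  assumes "inj r" and "Y \<subseteq> {ns. length ns = d}" and "length ns = d" and "max_length r ns \<le> m"
  shows "tuple_word r m ns \<in> padded_tuples r Y \<longleftrightarrow> ns \<in> Y"
proof
  assume "tuple_word r m ns \<in> padded_tuples r Y"
  then obtain m' ns' where ns': "ns' \<in> Y" "max_length r ns' \<le> m'"
    "tuple_word r m ns = tuple_word r m' ns'"
    unfolding padded_tuples_def by blast
  then have "m' = m" by (metis length_tuple_word)
  with ns' assms have "ns = ns'" by (intro tuple_word_inj[OF assms(1)]) auto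
  with ns'(1) show "ns \<in> Y" by simp
qed (use assms(4) in \<open>auto simp: padded_tuples_def\<close>)

lemma padded_tuples_lengths:
  "padded_tuples r {ns. length ns = d}
    = lists {c. length c = d} \<inter> (\<Inter>i\<in>{..<d}. map (\<lambda>c. c ! i) -` padded r UNIV)"
proof (intro equalityI subsetI)
  fix w assume "w \<in> padded_tuples r {ns. length ns = d}"
  then obtain m ns where ns: "length ns = d" "max_length r ns \<le> m" "w = tuple_word r m ns"
    unfolding padded_tuples_def by blast
  then have "map (\<lambda>c. c ! i) w \<in> padded r UNIV" if "i < d" for i
    using that by (auto simp: row_tuple_word max_length_le_iff intro!: pad_in_paddedI)
  moreover have "w \<in> lists {c. length c = d}"
    using ns by (auto dest: length_in_tuple_word)
  ultimately show "w \<in> lists {c. length c = d} \<inter> (\<Inter>i\<in>{..<d}. map (\<lambda>c. c ! i) -` padded r UNIV)"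
    by blast
next
  fix w assume w: "w \<in> lists {c. length c = d} \<inter> (\<Inter>i\<in>{..<d}. map (\<lambda>c. c ! i) -` padded r UNIV)"
  have "\<exists>n. map (\<lambda>c. c ! i) w = pad (length w) (r n) \<and> length (r n) \<le> length w" if "i < d" for i
  proof -
    have "map (\<lambda>c. c ! i) w \<in> padded r UNIV" using w that by blast
    then show ?thesis by (rule paddedE) (metis length_map)
  qed
  then obtain f where f: "\<And>i. i < d \<Longrightarrow> map (\<lambda>c. c ! i) w = pad (length w) (r (f i))"
    "\<And>i. i < d \<Longrightarrow> length (r (f i)) \<le> length w"
    by metis
  let ?ns = "map f [0..<d]"
  have "max_length r ?ns \<le> length w"
    using f(2) by (auto simp: max_length_le_iff)
  moreover from this have "w = tuple_word r (length w) ?ns"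
    using w f(1) by (intro tuple_word_eqI) auto
  ultimately show "w \<in> padded_tuples r {ns. length ns = d}"
    unfolding padded_tuples_def by (metis (mono_tags, lifting) CollectI diff_zero length_map length_upt)
qed

lemma finite_residuals_padded_tuples_lengths:
  assumes "finite_residuals (padded r UNIV)"
  shows "finite_residuals (padded_tuples r {ns. length ns = d})"
  unfolding padded_tuples_lengths
  by (intro finite_residuals_Int finite_residuals_lists finite_residuals_INT
      finite_residuals_vimage_map assms finite_lessThan)

lemma hd_tuple_word_max_length:
  assumes "tuple_word r (max_length r ns) ns \<noteq> []"
  shows "hd (tuple_word r (max_length r ns) ns) \<noteq> replicate (length ns) None"
proof
  assume blank: "hd (tuple_word r (max_length r ns) ns) = replicate (length ns) None"
  have pos: "0 < max_length r ns"
    using assms by (metis length_greater_0_conv length_tuple_word)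
  then have "map (\<lambda>n. pad (max_length r ns) (r n) ! 0) ns = replicate (length ns) None"
    using blank by (simp add: tuple_word_def hd_map)
  then have "\<forall>n\<in>set ns. pad (max_length r ns) (r n) ! 0 = None"
    by (simp flip: map_replicate_const)
  then have "length (r n) \<le> max_length r ns - 1" if "n \<in> set ns" for n
    using that pos pad_nth_None[OF length_le_max_length] by blast
  then have "max_length r ns \<le> max_length r ns - 1"
    by (simp add: max_length_le_iff)
  with pos show False by simp
qed

lemma padded_tuples_eq_left_padding:
  assumes "Y \<subseteq> {ns. length ns = d}"
  shows "padded_tuples r Y
    = left_padding (replicate d None) ((\<lambda>ns. tuple_word r (max_length r ns) ns) ` Y)"
proof (intro equalityI subsetI)
  fix w assume "w \<in> padded_tuples r Y"
  then obtain m ns where ns: "ns \<in> Y" "max_length r ns \<le> m" "w = tuple_word r m ns"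
    unfolding padded_tuples_def by blast
  then have "w = replicate (m - max_length r ns) (replicate d None) @ tuple_word r (max_length r ns) ns"
    using tuple_word_add[of r ns "max_length r ns" "m - max_length r ns"] assms by auto
  with ns(1) show "w \<in> left_padding (replicate d None) ((\<lambda>ns. tuple_word r (max_length r ns) ns) ` Y)"
    unfolding left_padding_eq by blast
next
  fix w assume "w \<in> left_padding (replicate d None) ((\<lambda>ns. tuple_word r (max_length r ns) ns) ` Y)"
  then obtain k ns where ns: "ns \<in> Y"
    "w = replicate k (replicate d None) @ tuple_word r (max_length r ns) ns"
    unfolding left_padding_eq by blast
  then have "w = tuple_word r (k + max_length r ns) ns"
    using tuple_word_add[of r ns "max_length r ns" k] assms by auto
  with ns(1) show "w \<in> padded_tuples r Y"
    unfolding padded_tuples_def by (metis (mono_tags, lifting) CollectI le_add2)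
qed

lemma finite_residuals_padded_tuples_iff:
  assumes "Y \<subseteq> {ns. length ns = d}"
  shows "finite_residuals (padded_tuples r Y)
    \<longleftrightarrow> finite_residuals ((\<lambda>ns. tuple_word r (max_length r ns) ns) ` Y)" (is "_ \<longleftrightarrow> finite_residuals ?W")
proof
  assume "finite_residuals ?W"
  then show "finite_residuals (padded_tuples r Y)"
    unfolding padded_tuples_eq_left_padding[OF assms] by (rule finite_residuals_left_padding)
next
  let ?B = "{w. w = [] \<or> hd w \<noteq> replicate d None}"
  assume "finite_residuals (padded_tuples r Y)"
  then have "finite_residuals (padded_tuples r Y \<inter> ?B)"
    by (intro finite_residuals_Int finite_residuals_hd_neq)
  moreover have "padded_tuples r Y \<inter> ?B = ?W"
    unfolding padded_tuples_eq_left_padding[OF assms]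
    using assms hd_tuple_word_max_length by (intro left_padding_Int_hd_neq) fastforce
  ultimately show "finite_residuals ?W" by simp
qed

lemma recognizable_iff_padded_tuples:
  assumes "range (rep L prec) \<subseteq> lists \<Sigma>" and "Y \<subseteq> {ns. length ns = d}"
  shows "recognizable \<Sigma> L prec d Y \<longleftrightarrow> finite_residuals (padded_tuples (rep L prec) Y)"
proof -
  let ?r = "rep L prec"
  have "set (pad m (?r n)) \<subseteq> Some ` \<Sigma> \<union> {None}" for m n
    using assms(1) by (auto simp: pad_def)
  moreover have "pad (max_length ?r ns) (?r n) ! j \<in> set (pad (max_length ?r ns) (?r n))"
    if "n \<in> set ns" "j < max_length ?r ns" for n ns j
    using that by (intro nth_mem) (simp add: length_le_max_length)
  ultimately have "rep_tuple L prec ` Y \<subseteq> lists (tuple_alph \<Sigma> d)"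
    using assms(2) by (fastforce simp: rep_tuple_eq_tuple_word tuple_word_def tuple_alph_def)
  then show ?thesis
    using assms(2) finite_residuals_padded_tuples_iff[OF assms(2), of ?r]
    by (simp add: recognizable_def regular_iff_finite_residuals rep_tuple_eq_tuple_word)
qed

lemma rows_padded_tuples:
  assumes "Y \<subseteq> {ns. length ns = d}" and "i < d"
  shows "left_stripping None (map (\<lambda>c. c ! i) ` padded_tuples r Y) = padded r ((\<lambda>ns. ns ! i) ` Y)"
    (is "left_stripping None ?rows = padded r ?N")
proof
  have row: "map (\<lambda>c. c ! i) (tuple_word r m ns) = pad m (r (ns ! i))" "length (r (ns ! i)) \<le> m"
    if "ns \<in> Y" "max_length r ns \<le> m" for m ns
    using that assms by (auto simp: row_tuple_word max_length_le_iff)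
  then have "?rows \<subseteq> padded r ?N"
    by (auto simp: padded_tuples_def intro!: pad_in_paddedI)
  then have "left_stripping None ?rows \<subseteq> left_stripping None (padded r ?N)"
    unfolding left_stripping_def by blast
  then show "left_stripping None ?rows \<subseteq> padded r ?N"
    by (simp only: left_stripping_padded)
  show "padded r ?N \<subseteq> left_stripping None ?rows"
  proof
    fix w assume "w \<in> padded r ?N"
    then obtain m ns where ns: "ns \<in> Y" "length (r (ns ! i)) \<le> m" "w = pad m (r (ns ! i))"
      unfolding padded_def by auto
    then have "replicate (max_length r ns) None @ w = pad (max_length r ns + m) (r (ns ! i))"
      by (simp add: pad_add)
    also have "\<dots> = map (\<lambda>c. c ! i) (tuple_word r (max_length r ns + m) ns)"
      using row ns(1) by simp
    finally have "replicate (max_length r ns) None @ w \<in> ?rows"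
      using ns(1) unfolding padded_tuples_def by force
    then show "w \<in> left_stripping None ?rows"
      unfolding left_stripping_def by blast
  qed
qed

lemma finite_residuals_padded_component:
  assumes "finite_residuals (padded_tuples r Y)" and "Y \<subseteq> {ns. length ns = d}" and "i < d"
  shows "finite_residuals (padded r ((\<lambda>ns. ns ! i) ` Y))"
  unfolding rows_padded_tuples[OF assms(2,3), symmetric]
  using assms(1) by (intro finite_residuals_left_stripping finite_residuals_image_map)

section \<open>Definable predicates\<close>

definition env_word :: "(nat \<Rightarrow> 'a list) \<Rightarrow> nat \<Rightarrow> ('v \<Rightarrow> nat) \<Rightarrow> ('v \<Rightarrow> 'a option) list" where
  "env_word r m e = map (\<lambda>j v. pad m (r (e v)) ! j) [0..<m]"

text \<open>With a track for every variable no arities have to be recorded. The price is that only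
  environments whose values have representations of bounded length can be encoded.\<close>

definition definable :: "(nat \<Rightarrow> 'a list) \<Rightarrow> (('v \<Rightarrow> nat) \<Rightarrow> bool) \<Rightarrow> bool" where
  "definable r P \<longleftrightarrow> (\<exists>K. finite_residuals K \<and>
     (\<forall>e m. (\<forall>v. length (r (e v)) \<le> m) \<longrightarrow> (env_word r m e \<in> K \<longleftrightarrow> P e)))"

lemma definableI:
  assumes "finite_residuals K"
    and "\<And>e m. (\<And>v. length (r (e v)) \<le> m) \<Longrightarrow> env_word r m e \<in> K \<longleftrightarrow> P e"
  shows "definable r P"
  using assms unfolding definable_def by blast

lemma length_env_word [simp]: "length (env_word r m e) = m"
  by (simp add: env_word_def)

lemma track_env_word:
  "length (r (e v)) \<le> m \<Longrightarrow> map (\<lambda>c. c v) (env_word r m e) = pad m (r (e v))"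
  by (auto simp: env_word_def intro!: nth_equalityI)

lemma map_env_word: "map (\<lambda>c v. c (f v)) (env_word r m e) = env_word r m (\<lambda>v. e (f v))"
  by (simp add: env_word_def)

lemma env_word_eqI:
  assumes "length w = m" and "\<And>v. map (\<lambda>c. c v) w = pad m (r (e v))"
  shows "w = env_word r m e"
proof (rule nth_equalityI)
  fix j assume j: "j < length w"
  have "(w ! j) v = pad m (r (e v)) ! j" for v
    using assms(2)[of v] j by (metis nth_map)
  then show "w ! j = env_word r m e ! j"
    using assms(1) j by (auto simp: env_word_def)
qed (simp add: assms(1))

lemma env_word_add:
  assumes "\<And>v. length (r (e v)) \<le> m"
  shows "env_word r (k + m) e = replicate k (\<lambda>_. None) @ env_word r m e"
  using assms by (intro env_word_eqI[symmetric]) (simp_all add: track_env_word pad_add)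

lemma env_word_case_optionI:
  assumes "map (\<lambda>c v. c (Some v)) u = env_word r m e" and "map (\<lambda>c. c None) u = pad m (r n)"
    and "\<And>v. length (r (e v)) \<le> m"
  shows "u = env_word r m (case_option n e)"
proof (rule env_word_eqI)
  show "length u = m"
    using arg_cong[OF assms(1), of length] by simp
  fix v show "map (\<lambda>c. c v) u = pad m (r (case_option n e v))"
  proof (cases v)
    case (Some w)
    have "map (\<lambda>c. c (Some w)) u = map (\<lambda>c. c w) (env_word r m e)"
      unfolding assms(1)[symmetric] by simp
    then show ?thesis using assms(3) Some by (simp add: track_env_word)
  qed (simp add: assms(2))
qed

lemma definable_not:
  assumes "definable r P"
  shows "definable r (\<lambda>e. \<not> P e)"
proof -
  obtain K where "finite_residuals K"
    "\<And>e m. (\<And>v. length (r (e v)) \<le> m) \<Longrightarrow> env_word r m e \<in> K \<longleftrightarrow> P e"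
    using assms unfolding definable_def by metis
  then show ?thesis
    by (intro definableI[of "- K"]) (simp_all add: finite_residuals_Compl)
qed

lemma definable_ball:
  assumes "finite I" and "\<And>i. i \<in> I \<Longrightarrow> definable r (P i)"
  shows "definable r (\<lambda>e. \<forall>i\<in>I. P i e)"
proof -
  obtain K where "\<And>i. i \<in> I \<Longrightarrow> finite_residuals (K i)"
    "\<And>i e m. i \<in> I \<Longrightarrow> (\<forall>v. length (r (e v)) \<le> m) \<Longrightarrow> (env_word r m e \<in> K i \<longleftrightarrow> P i e)"
    using assms(2) unfolding definable_def by metis
  then show ?thesis
    using assms(1) by (intro definableI[of "\<Inter>i\<in>I. K i"]) (auto intro: finite_residuals_INT)
qed

lemma definable_bex:
  assumes "finite I" and "\<And>i. i \<in> I \<Longrightarrow> definable r (P i)"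
  shows "definable r (\<lambda>e. \<exists>i\<in>I. P i e)"
  using definable_not[OF definable_ball[OF assms(1) definable_not[OF assms(2)]]] by simp

lemma definable_conj:
  assumes "definable r P" and "definable r Q"
  shows "definable r (\<lambda>e. P e \<and> Q e)"
proof -
  have "definable r (\<lambda>e. \<forall>R\<in>{P, Q}. R e)" using assms by (intro definable_ball) auto
  then show ?thesis by simp
qed

lemma definable_const: "definable r (\<lambda>e. b)"
  by (rule definableI[of "if b then UNIV else {}"])
    (simp_all add: finite_residuals_UNIV finite_residuals_empty)

lemma definable_rename:
  assumes "definable r P"
  shows "definable r (\<lambda>e. P (\<lambda>v. e (f v)))"
proof -
  obtain K where "finite_residuals K"
    "\<And>e m. (\<And>v. length (r (e v)) \<le> m) \<Longrightarrow> env_word r m e \<in> K \<longleftrightarrow> P e"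
    using assms unfolding definable_def by metis
  then show ?thesis
    by (intro definableI[of "map (\<lambda>c v. c (f v)) -` K"])
      (simp_all add: finite_residuals_vimage_map map_env_word)
qed

lemma definable_Collect_eq:
  assumes "finite I" and "\<And>i. i \<in> I \<Longrightarrow> definable r (P i)" and "J \<subseteq> I"
  shows "definable r (\<lambda>e. {i\<in>I. P i e} = J)"
proof -
  have "definable r (\<lambda>e. P i e \<longleftrightarrow> i \<in> J)" if "i \<in> I" for i
    using assms(2)[OF that] by (cases "i \<in> J") (simp_all add: definable_not)
  then have "definable r (\<lambda>e. \<forall>i\<in>I. P i e \<longleftrightarrow> i \<in> J)"
    by (rule definable_ball[OF assms(1)])
  moreover have "(\<forall>i\<in>I. P i e \<longleftrightarrow> i \<in> J) \<longleftrightarrow> {i\<in>I. P i e} = J" for e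
    using assms(3) by blast
  ultimately show ?thesis by simp
qed

lemma definable_card_less:
  assumes "finite I" and "\<And>i. i \<in> I \<Longrightarrow> definable r (P i)"
    and "finite J" and "\<And>j. j \<in> J \<Longrightarrow> definable r (Q j)"
  shows "definable r (\<lambda>e. card {i\<in>I. P i e} < card {j\<in>J. Q j e})"
proof -
  have "definable r (\<lambda>e. \<exists>I'\<in>Pow I. \<exists>J'\<in>Pow J.
      ({i\<in>I. P i e} = I' \<and> {j\<in>J. Q j e} = J') \<and> card I' < card J')"
    using assms
    by (intro definable_bex definable_conj definable_const definable_Collect_eq) auto
  moreover have "(\<exists>I'\<in>Pow I. \<exists>J'\<in>Pow J.
      ({i\<in>I. P i e} = I' \<and> {j\<in>J. Q j e} = J') \<and> card I' < card J')
    \<longleftrightarrow> card {i\<in>I. P i e} < card {j\<in>J. Q j e}" for e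
    by auto
  ultimately show ?thesis by simp
qed

lemma definable_mem:
  assumes "inj r" and "finite_residuals (padded r N)"
  shows "definable r (\<lambda>e. e v \<in> N)"
  using assms by (intro definableI[of "map (\<lambda>c. c v) -` padded r N"])
    (simp_all add: finite_residuals_vimage_map track_env_word pad_in_padded_iff)

text \<open>The witness may have a longer representation than the values of \<open>e\<close>, hence the
  blank columns stripped after the projection.\<close>

lemma env_word_in_projection_iff:
  assumes "\<And>v. length (r (e v)) \<le> m"
  shows "env_word r m e \<in> left_stripping (\<lambda>_. None)
      (map (\<lambda>c v. c (Some v)) ` (K \<inter> map (\<lambda>c. c None) -` padded r UNIV))
    \<longleftrightarrow> (\<exists>k n. length (r n) \<le> k + m \<and> env_word r (k + m) (case_option n e) \<in> K)"
    (is "_ \<in> left_stripping _ (?project ` ?K') \<longleftrightarrow> _")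
proof
  assume "env_word r m e \<in> left_stripping (\<lambda>_. None) (?project ` ?K')"
  then obtain k u where u: "u \<in> ?K'" "?project u = replicate k (\<lambda>_. None) @ env_word r m e"
    unfolding left_stripping_def by (auto dest: sym)
  then have project: "?project u = env_word r (k + m) e"
    using env_word_add[of r e m k] assms by simp
  then have len: "length u = k + m"
    by (metis length_env_word length_map)
  have "map (\<lambda>c. c None) u \<in> padded r UNIV" using u(1) by simp
  then obtain n where n: "map (\<lambda>c. c None) u = pad (k + m) (r n)" "length (r n) \<le> k + m"
    by (rule paddedE) (metis len length_map)
  have "u = env_word r (k + m) (case_option n e)"
    using project n(1) assms by (intro env_word_case_optionI) (simp_all add: trans_le_add2)
  with u(1) n(2) show "\<exists>k n. length (r n) \<le> k + m \<and> env_word r (k + m) (case_option n e) \<in> K"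
    by blast
next
  assume "\<exists>k n. length (r n) \<le> k + m \<and> env_word r (k + m) (case_option n e) \<in> K"
  then obtain k n where n: "length (r n) \<le> k + m" "env_word r (k + m) (case_option n e) \<in> K"
    by blast
  then have "env_word r (k + m) (case_option n e) \<in> ?K'"
    by (simp add: track_env_word pad_in_paddedI)
  moreover have "?project (env_word r (k + m) (case_option n e)) = replicate k (\<lambda>_. None) @ env_word r m e"
    using env_word_add[of r e m k] assms by (simp add: map_env_word)
  ultimately have "replicate k (\<lambda>_. None) @ env_word r m e \<in> ?project ` ?K'"
    by (metis imageI)
  then show "env_word r m e \<in> left_stripping (\<lambda>_. None) (?project ` ?K')"
    unfolding left_stripping_def by blast
qed

lemma definable_ex:
  fixes P :: "('v option \<Rightarrow> nat) \<Rightarrow> bool"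
  assumes "definable r P" and "finite_residuals (padded r UNIV)"
  shows "definable r (\<lambda>e. \<exists>n. P (case_option n e))"
proof -
  obtain K where K: "finite_residuals K"
    "\<And>e m. \<forall>v. length (r (e v)) \<le> m \<Longrightarrow> env_word r m e \<in> K \<longleftrightarrow> P e"
    using assms(1) unfolding definable_def by metis
  show ?thesis
  proof (rule definableI)
    show "finite_residuals (left_stripping (\<lambda>_. None)
        (map (\<lambda>c v. c (Some v)) ` (K \<inter> map (\<lambda>c. c None) -` padded r UNIV)))"
      by (intro finite_residuals_left_stripping finite_residuals_image_map finite_residuals_Int
          finite_residuals_vimage_map K(1) assms(2))
    fix e :: "'v \<Rightarrow> nat" and m assume e: "\<And>v. length (r (e v)) \<le> m"
    have "env_word r (k + m) (case_option n e) \<in> K \<longleftrightarrow> P (case_option n e)"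
      if "length (r n) \<le> k + m" for k n
      using that e by (intro K(2)) (simp add: trans_le_add2 split: option.split)
    moreover have "length (r n) \<le> length (r n) + m" for n by simp
    ultimately show "env_word r m e \<in> left_stripping (\<lambda>_. None)
        (map (\<lambda>c v. c (Some v)) ` (K \<inter> map (\<lambda>c. c None) -` padded r UNIV))
      \<longleftrightarrow> (\<exists>n. P (case_option n e))"
      unfolding env_word_in_projection_iff[of r e m K, OF e] by metis
  qed
qed

lemma definable_ex_update:
  assumes "definable r P" and "finite_residuals (padded r UNIV)"
  shows "definable r (\<lambda>e. \<exists>n. P (e(v := n)))"
proof -
  let ?f = "\<lambda>w. if w = v then None else Some w"
  have "(\<lambda>w. case_option n e (?f w)) = e(v := n)" for n and e :: "'b \<Rightarrow> nat"
    by auto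
  then show ?thesis
    using definable_ex[OF definable_rename[OF assms(1), of ?f] assms(2)] by simp
qed

lemma definable_ex_family:
  fixes P :: "('v + 'w \<Rightarrow> nat) \<Rightarrow> bool"
  assumes "finite W" and "definable r P" and "finite_residuals (padded r UNIV)"
    and "\<And>e p q. (\<And>w. w \<in> W \<Longrightarrow> p w = q w) \<Longrightarrow> P (case_sum e p) \<longleftrightarrow> P (case_sum e q)"
  shows "definable r (\<lambda>e. \<exists>p. P (case_sum e p))"
  using assms(1,2,4)
proof (induction W arbitrary: P rule: finite_induct)
  case empty
  let ?f = "case_sum id (\<lambda>_. undefined)"
  have "definable r (\<lambda>e. P (\<lambda>v. e (?f v)))"
    by (rule definable_rename[OF empty.prems(1)])
  moreover have "(\<exists>p. P (case_sum e p)) \<longleftrightarrow> P (\<lambda>v. e (?f v))" for e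
  proof -
    have f: "(\<lambda>v. e (?f v)) = case_sum e (\<lambda>_. e undefined)"
      by (auto split: sum.split)
    show ?thesis
      unfolding f using empty.prems(2) by blast
  qed
  ultimately show ?case by simp
next
  case (insert w W)
  have update: "(case_sum e p)(Inr w := n) = case_sum e (p(w := n))" for e :: "'v \<Rightarrow> nat" and p n
    by (auto split: sum.split)
  have "definable r (\<lambda>e. \<exists>p n. P ((case_sum e p)(Inr w := n)))"
  proof (rule insert.IH)
    show "definable r (\<lambda>e. \<exists>n. P (e(Inr w := n)))"
      by (rule definable_ex_update[OF insert.prems(1) assms(3)])
    fix e :: "'v \<Rightarrow> nat" and p q :: "'w \<Rightarrow> nat"
    assume "\<And>w. w \<in> W \<Longrightarrow> p w = q w"
    then have "P (case_sum e (p(w := n))) \<longleftrightarrow> P (case_sum e (q(w := n)))" for n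
      by (intro insert.prems(2)) auto
    then show "(\<exists>n. P ((case_sum e p)(Inr w := n))) \<longleftrightarrow> (\<exists>n. P ((case_sum e q)(Inr w := n)))"
      by (simp add: update)
  qed
  moreover have "(\<exists>p n. P (case_sum e (p(w := n)))) \<longleftrightarrow> (\<exists>p. P (case_sum e p))" for e
    by (metis fun_upd_triv)
  ultimately show ?case by (simp add: update)
qed

lemma tuple_word_map_upt:
  "tuple_word r m (map e [0..<d]) = map (\<lambda>c. map c [0..<d]) (env_word r m e)"
  by (simp add: tuple_word_def env_word_def comp_def)

lemma finite_residuals_imp_definable_tuple:
  assumes "inj r" and "Y \<subseteq> {ns. length ns = d}" and "finite_residuals (padded_tuples r Y)"
  shows "definable r (\<lambda>e. map e [0..<d] \<in> Y)"
proof (rule definableI)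
  show "finite_residuals (map (\<lambda>c. map c [0..<d]) -` padded_tuples r Y)"
    using assms(3) by (rule finite_residuals_vimage_map)
  show "env_word r m e \<in> map (\<lambda>c. map c [0..<d]) -` padded_tuples r Y \<longleftrightarrow> map e [0..<d] \<in> Y"
    if "\<And>v. length (r (e v)) \<le> m" for e m
    using tuple_word_in_padded_tuples_iff[OF assms(1,2), of "map e [0..<d]" m] that
    by (simp add: max_length_le_iff flip: tuple_word_map_upt)
qed

lemma definable_tuple_imp_finite_residuals:
  assumes "inj r" and "Y \<subseteq> {ns. length ns = d}" and "finite_residuals (padded r UNIV)"
    and "definable r (\<lambda>e. map e [0..<d] \<in> Y)"
  shows "finite_residuals (padded_tuples r Y)"
proof (cases "d = 0")
  case True
  then have "Y = {} \<or> Y = {[]}" using assms(2) by auto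
  moreover have "padded_tuples r {[]} = lists {[]}"
    using padded_tuples_lengths[of r 0] by (simp add: lists_def)
  moreover have "padded_tuples r {} = {}" by (simp add: padded_tuples_def)
  ultimately show ?thesis
    using finite_residuals_lists finite_residuals_empty by metis
next
  case False
  obtain K where K: "finite_residuals K"
    "\<And>e m. (\<And>v. length (r (e v)) \<le> m) \<Longrightarrow> env_word r m e \<in> K \<longleftrightarrow> map e [0..<d] \<in> Y"
    using assms(4) unfolding definable_def by metis
  \<comment> \<open>The variables from \<open>d\<close> on need values as well, so the tuple is repeated cyclically.\<close>
  define cycle :: "'a option list \<Rightarrow> nat \<Rightarrow> 'a option" where "cycle c v = c ! (v mod d)" for c v
  have tuple_word_in_K: "map cycle (tuple_word r m ns) \<in> K \<longleftrightarrow> ns \<in> Y"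
    if "length ns = d" "max_length r ns \<le> m" for m ns
  proof -
    let ?e = "\<lambda>v. ns ! (v mod d)"
    have "map cycle (tuple_word r m ns) = env_word r m ?e"
      using that(1) False by (simp add: tuple_word_def env_word_def cycle_def fun_eq_iff)
    moreover have "length (r (?e v)) \<le> m" for v
      using that False by (simp add: max_length_le_iff)
    moreover have "map ?e [0..<d] = ns"
      using that(1) by (auto intro: nth_equalityI)
    ultimately show ?thesis using K(2)[of ?e m] by simp
  qed
  have "padded_tuples r Y = padded_tuples r {ns. length ns = d} \<inter> map cycle -` K"
    using assms(2) tuple_word_in_K by (auto simp: padded_tuples_def) blast+
  then show ?thesis
    by (simp add: finite_residuals_Int finite_residuals_vimage_map
        finite_residuals_padded_tuples_lengths assms(3) K(1))
qed

section \<open>The winning shift\<close>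

definition plays :: "('b list \<Rightarrow> 'b set) \<Rightarrow> (nat \<Rightarrow> 'b) set" where
  "plays \<sigma> = {b. \<forall>j. b j \<in> \<sigma> (prefix j b)}"

definition continuations :: "(nat \<Rightarrow> 'b) set \<Rightarrow> 'b list \<Rightarrow> 'b set" where
  "continuations Z h = {z (length h) | z. z \<in> Z \<and> prefix (length h) z = h}"

lemma mem_continuations_iff:
  "c \<in> continuations Z h \<longleftrightarrow> (\<exists>z\<in>Z. prefix (length h) z = h \<and> z (length h) = c)"
  unfolding continuations_def by blast

lemma nth_in_continuations: "z \<in> Z \<Longrightarrow> z m \<in> continuations Z (prefix m z)"
  by (auto simp: mem_continuations_iff)

lemma continuations_subset:
  assumes "\<And>z. z \<in> Z \<Longrightarrow> range z \<subseteq> A"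
  shows "continuations Z h \<subseteq> A"
  using assms by (fastforce simp: mem_continuations_iff)

lemma winning_shift_iff_plays:
  "\<alpha> \<in> winning_shift A X \<longleftrightarrow> (\<forall>j. \<alpha> j < card A) \<and>
    (\<exists>\<sigma>. (\<forall>h. \<sigma> h \<subseteq> A \<and> card (\<sigma> h) = \<alpha> (length h) + 1) \<and> plays \<sigma> \<subseteq> X)"
  unfolding winning_shift_def plays_def subsequence_def by blast

lemma plays_extend:
  assumes "\<forall>h. \<sigma> h \<noteq> {}" and "\<And>j. j < length h \<Longrightarrow> h ! j \<in> \<sigma> (take j h)"
  obtains b where "b \<in> plays \<sigma>" and "prefix (length h) b = h"
proof -
  have "\<exists>b. \<forall>j. if j < length h then b j = h ! j else b j \<in> \<sigma> (prefix j b)"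
  proof (rule dependent_wellorder_choice)
    fix f g :: "nat \<Rightarrow> 'a" and c j
    assume "\<And>i. i < j \<Longrightarrow> f i = g i"
    then have "prefix j f = prefix j g"
      by (simp add: subsequence_def)
    then show "(if j < length h then c = h ! j else c \<in> \<sigma> (prefix j f))
        = (if j < length h then c = h ! j else c \<in> \<sigma> (prefix j g))" by simp
  qed (use assms(1) in auto)
  then obtain b where b: "\<And>j. if j < length h then b j = h ! j else b j \<in> \<sigma> (prefix j b)" by blast
  have take: "prefix j b = take j h" if "j \<le> length h" for j
    using that b by (intro nth_equalityI) (auto split: if_splits)
  have "b j \<in> \<sigma> (prefix j b)" for j
    using b[of j] assms(2)[of j] take[of j] by (cases "j < length h") auto
  then show thesis
    using that[of b] take[of "length h"] by (simp add: plays_def)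
qed

lemma continuations_plays:
  assumes "\<forall>h. \<sigma> h \<noteq> {}" and "z \<in> plays \<sigma>"
  shows "continuations (plays \<sigma>) (prefix m z) = \<sigma> (prefix m z)"
proof (intro equalityI subsetI)
  fix c assume c: "c \<in> \<sigma> (prefix m z)"
  let ?h = "prefix m z @ [c]"
  have "?h ! j \<in> \<sigma> (take j ?h)" if "j < length ?h" for j
    using that c assms(2) by (auto simp: nth_append plays_def less_Suc_eq min_def)
  then obtain b where "b \<in> plays \<sigma>" "prefix (length ?h) b = ?h"
    by (rule plays_extend[OF assms(1)])
  then show "c \<in> continuations (plays \<sigma>) (prefix m z)"
    by (auto simp: mem_continuations_iff)
next
  fix c assume "c \<in> continuations (plays \<sigma>) (prefix m z)"
  then obtain b where b: "b \<in> plays \<sigma>" "prefix m b = prefix m z" "b m = c"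
    by (auto simp: mem_continuations_iff)
  from b(1) have "b m \<in> \<sigma> (prefix m b)" by (simp add: plays_def)
  then show "c \<in> \<sigma> (prefix m z)" unfolding b(2,3) .
qed

lemma winning_shift_imp_branching:
  assumes "\<alpha> \<in> winning_shift A X"
  obtains Z where "Z \<subseteq> X" and "Z \<noteq> {}"
    and "\<And>z m. z \<in> Z \<Longrightarrow> card (continuations Z (prefix m z)) = \<alpha> m + 1"
proof -
  obtain \<sigma> where \<sigma>: "\<And>h. card (\<sigma> h) = \<alpha> (length h) + 1" and win: "plays \<sigma> \<subseteq> X"
    using assms unfolding winning_shift_iff_plays by blast
  have nonempty: "\<forall>h. \<sigma> h \<noteq> {}"
    using \<sigma> by (metis Suc_eq_plus1 card.empty nat.distinct(1))
  show thesis
  proof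
    show "plays \<sigma> \<noteq> {}"
      using plays_extend[OF nonempty, of "[]"] by auto
    show "card (continuations (plays \<sigma>) (prefix m z)) = \<alpha> m + 1" if "z \<in> plays \<sigma>" for z m
      using continuations_plays[OF nonempty that] \<sigma> by simp
  qed (rule win)
qed

lemma prefix_play_in_prefixes:
  assumes "Z \<noteq> {}" and "\<And>h. continuations Z h \<noteq> {} \<Longrightarrow> \<sigma> h \<subseteq> continuations Z h" and "b \<in> plays \<sigma>"
  shows "prefix n b \<in> prefix n ` Z"
proof (induction n)
  case 0
  then show ?case using assms(1) by auto
next
  case (Suc n)
  then obtain z where z: "z \<in> Z" "prefix n b = prefix n z" by blast
  have "continuations Z (prefix n b) \<noteq> {}"
    unfolding z(2) using nth_in_continuations[OF z(1)] by blast
  then have "b n \<in> continuations Z (prefix n b)"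
    using assms(2,3) by (auto simp: plays_def)
  then obtain z' where "z' \<in> Z" "prefix n z' = prefix n b" "z' n = b n"
    by (auto simp: mem_continuations_iff)
  then show ?case by (intro image_eqI[of _ _ z']) simp_all
qed

lemma branching_imp_winning_shift:
  assumes "finite A" and "\<And>z. z \<in> Z \<Longrightarrow> range z \<subseteq> A" and "Z \<noteq> {}"
    and branching: "\<And>z m. z \<in> Z \<Longrightarrow> \<alpha> m < card (continuations Z (prefix m z))"
    and limits: "\<And>b. (\<And>n. prefix n b \<in> prefix n ` Z) \<Longrightarrow> b \<in> X"
  shows "\<alpha> \<in> winning_shift A X"
proof -
  have subset: "continuations Z h \<subseteq> A" for h
    by (rule continuations_subset[OF assms(2)])
  have card_A: "\<alpha> m < card A" for m
    using assms(1,3) branching subset by (metis all_not_in_conv card_mono order_less_le_trans)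
  define moves where "moves h = (if continuations Z h = {} then A else continuations Z h)" for h
  have "\<exists>B\<subseteq>moves h. card B = \<alpha> (length h) + 1" for h
  proof (rule obtain_subset_with_card_n[of "\<alpha> (length h) + 1" "moves h"])
    show "\<alpha> (length h) + 1 \<le> card (moves h)"
    proof (cases "continuations Z h = {}")
      case True
      then show ?thesis using card_A[of "length h"] by (simp add: moves_def)
    next
      case False
      then obtain z where "z \<in> Z" "prefix (length h) z = h" by (auto simp: mem_continuations_iff)
      then show ?thesis using False branching[of z "length h"] by (simp add: moves_def)
    qed
  qed blast
  then obtain \<sigma> where \<sigma>: "\<And>h. \<sigma> h \<subseteq> moves h" "\<And>h. card (\<sigma> h) = \<alpha> (length h) + 1" by metis
  have "plays \<sigma> \<subseteq> X"
    using prefix_play_in_prefixes[OF assms(3)] \<sigma>(1) limits by (simp add: moves_def subset_iff) metis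
  moreover have "\<sigma> h \<subseteq> A" for h
    using \<sigma>(1)[of h] subset[of h] by (auto simp: moves_def split: if_splits)
  ultimately show ?thesis
    using card_A \<sigma>(2) unfolding winning_shift_iff_plays by blast
qed

lemma prefixes_Suc: "prefix (Suc n) ` Z = (\<Union>h\<in>prefix n ` Z. (\<lambda>c. h @ [c]) ` continuations Z h)"
proof (intro equalityI subsetI)
  fix w assume "w \<in> prefix (Suc n) ` Z"
  then obtain z where z: "z \<in> Z" "w = prefix n z @ [z n]" by auto
  with nth_in_continuations[OF z(1), of n]
  show "w \<in> (\<Union>h\<in>prefix n ` Z. (\<lambda>c. h @ [c]) ` continuations Z h)" by blast
next
  fix w assume "w \<in> (\<Union>h\<in>prefix n ` Z. (\<lambda>c. h @ [c]) ` continuations Z h)"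
  then obtain h c where h: "h \<in> prefix n ` Z" "c \<in> continuations Z h" "w = h @ [c]" by blast
  then have "length h = n" by auto
  with h(2,3) obtain z where "z \<in> Z" "w = prefix (Suc n) z" by (auto simp: mem_continuations_iff)
  then show "w \<in> prefix (Suc n) ` Z" by blast
qed

lemma card_prefixes_le:
  assumes "\<And>z m. z \<in> Z \<Longrightarrow> finite (continuations Z (prefix m z))"
    and "\<And>z m. z \<in> Z \<Longrightarrow> card (continuations Z (prefix m z)) \<le> \<alpha> m + 1"
  shows "finite (prefix n ` Z) \<and> card (prefix n ` Z) \<le> 2 ^ (\<Sum>j<n. \<alpha> j)"
proof (induction n)
  case 0
  have "prefix 0 ` Z \<subseteq> {[]}" by auto
  then show ?case using card_mono[of "{[]}"] by (auto dest: finite_subset)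
next
  case (Suc n)
  have "card (prefix (Suc n) ` Z) \<le> (\<Sum>h\<in>prefix n ` Z. card ((\<lambda>c. h @ [c]) ` continuations Z h))"
    unfolding prefixes_Suc using Suc by (intro card_UN_le) simp
  also have "\<dots> \<le> (\<Sum>h\<in>prefix n ` Z. \<alpha> n + 1)"
    using assms by (intro sum_mono) (auto intro: order_trans[OF card_image_le])
  also have "\<dots> = card (prefix n ` Z) * (\<alpha> n + 1)" by simp
  also have "\<dots> \<le> 2 ^ (\<Sum>j<n. \<alpha> j) * 2 ^ \<alpha> n"
    using Suc by (intro mult_mono) (auto simp: Suc_leI)
  finally have "card (prefix (Suc n) ` Z) \<le> 2 ^ (\<Sum>j<Suc n. \<alpha> j)" by (simp add: power_add)
  moreover have "finite (prefix (Suc n) ` Z)"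
    unfolding prefixes_Suc using Suc assms(1) by (intro finite_UN_I) auto
  ultimately show ?case by blast
qed

lemma continuations_eq_prefixes:
  assumes "length h < n"
  shows "continuations Z h = {w ! length h | w. w \<in> prefix n ` Z \<and> take (length h) w = h}"
  using assms by (force simp: continuations_def)

lemma mem_subshift_gen_iff:
  "y \<in> subshift_gen A x \<longleftrightarrow> range y \<subseteq> A \<and> (\<forall>n. \<exists>k. prefix n y = prefix n (suffix k x))"
  by (auto simp: subshift_gen_def list_eq_iff_nth_eq simp del: subsequence_shift)

lemma limit_in_subshift_gen:
  assumes "\<And>n. prefix n b \<in> prefix n ` subshift_gen A x"
  shows "b \<in> subshift_gen A x"
  unfolding mem_subshift_gen_iff
proof (intro conjI allI subsetI)
  fix c assume "c \<in> range b"
  then obtain n where c: "c = b n" by blast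
  obtain y where "y \<in> subshift_gen A x" "prefix (Suc n) b = prefix (Suc n) y"
    using assms by blast
  then show "c \<in> A" unfolding c mem_subshift_gen_iff by auto
next
  fix n show "\<exists>k. prefix n b = prefix n (suffix k x)"
    using assms[of n] by (auto simp: mem_subshift_gen_iff)
qed

lemma subshift_gen_positions:
  assumes "Z \<subseteq> subshift_gen A x" and "finite (prefix n ` Z)"
  obtains S where "finite S" and "card S \<le> card (prefix n ` Z)"
    and "prefix n ` (\<lambda>q. suffix q x) ` S = prefix n ` Z"
proof -
  have "\<exists>k. prefix n (suffix k x) = w" if "w \<in> prefix n ` Z" for w
    using that assms(1) by (auto simp del: subsequence_shift) (metis mem_subshift_gen_iff subsetD)
  then obtain p where p: "\<And>w. w \<in> prefix n ` Z \<Longrightarrow> prefix n (suffix (p w) x) = w" by metis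
  show thesis
  proof
    show "finite (p ` prefix n ` Z)" using assms(2) by blast
    show "card (p ` prefix n ` Z) \<le> card (prefix n ` Z)" by (rule card_image_le[OF assms(2)])
    show "prefix n ` (\<lambda>q. suffix q x) ` p ` prefix n ` Z = prefix n ` Z"
      using p by (simp only: image_image) simp
  qed
qed

lemma winning_shift_imp_positions:
  assumes "\<alpha> \<in> winning_shift A (subshift_gen A x)"
  obtains S where "finite S" and "S \<noteq> {}" and "card S \<le> 2 ^ (\<Sum>j<n. \<alpha> j)"
    and "\<And>q m. q \<in> S \<Longrightarrow> m < n \<Longrightarrow>
      card (continuations ((\<lambda>q. suffix q x) ` S) (x [q \<rightarrow> q + m])) = \<alpha> m + 1"
proof -
  obtain Z where Z: "Z \<subseteq> subshift_gen A x" "Z \<noteq> {}"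
    and branching: "\<And>z m. z \<in> Z \<Longrightarrow> card (continuations Z (prefix m z)) = \<alpha> m + 1"
    using assms by (rule winning_shift_imp_branching) blast
  have "finite (continuations Z (prefix m z))" if "z \<in> Z" for z m
    using branching[OF that, of m] by (intro card_ge_0_finite) simp
  then have prefixes: "finite (prefix n ` Z)" "card (prefix n ` Z) \<le> 2 ^ (\<Sum>j<n. \<alpha> j)"
    using card_prefixes_le[of Z \<alpha> n] branching by auto
  obtain S where S: "finite S" "card S \<le> card (prefix n ` Z)"
    and S_prefixes: "prefix n ` (\<lambda>q. suffix q x) ` S = prefix n ` Z"
    using Z(1) prefixes(1) by (rule subshift_gen_positions)
  show thesis
  proof
    show "finite S" by (rule S(1))
    show "S \<noteq> {}" using Z(2) S_prefixes by blast
    show "card S \<le> 2 ^ (\<Sum>j<n. \<alpha> j)" using S(2) prefixes(2) by simp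
    fix q m assume q: "q \<in> S" and m: "m < n"
    then obtain z where z: "z \<in> Z" "prefix n (suffix q x) = prefix n z"
      using S_prefixes by blast
    have "x [q \<rightarrow> q + m] = take m (prefix n (suffix q x))" using m by simp
    also have "\<dots> = prefix m z" unfolding z(2) using m by simp
    finally have "continuations ((\<lambda>q. suffix q x) ` S) (x [q \<rightarrow> q + m]) = continuations Z (prefix m z)"
      using m by (simp add: continuations_eq_prefixes[of _ n] S_prefixes)
    then show "card (continuations ((\<lambda>q. suffix q x) ` S) (x [q \<rightarrow> q + m])) = \<alpha> m + 1"
      using branching[OF z(1)] by simp
  qed
qed

lemma positions_imp_winning_shift:
  assumes "finite A" and "range x \<subseteq> A" and "S \<noteq> {}"
    and choices: "\<And>q m. q \<in> S \<Longrightarrow> \<alpha> m \<noteq> 0 \<Longrightarrow>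
      \<alpha> m < card (continuations ((\<lambda>q. suffix q x) ` S) (x [q \<rightarrow> q + m]))"
  shows "\<alpha> \<in> winning_shift A (subshift_gen A x)"
proof (rule branching_imp_winning_shift)
  let ?Z = "(\<lambda>q. suffix q x) ` S"
  show range: "range z \<subseteq> A" if "z \<in> ?Z" for z
    using that assms(2) by auto
  have "?Z \<subseteq> subshift_gen A x"
    using assms(2) by (fastforce simp: mem_subshift_gen_iff)
  then show "b \<in> subshift_gen A x" if "\<And>n. prefix n b \<in> prefix n ` ?Z" for b
    using that by (intro limit_in_subshift_gen) blast
  show "\<alpha> m < card (continuations ?Z (prefix m z))" if z: "z \<in> ?Z" for z m
  proof (cases "\<alpha> m = 0")
    case True
    have "continuations ?Z (prefix m z) \<subseteq> A"
      by (rule continuations_subset[OF range])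
    moreover have "z m \<in> continuations ?Z (prefix m z)"
      using z by (rule nth_in_continuations)
    ultimately show ?thesis
      using True assms(1) by (metis card_gt_0_iff empty_iff finite_subset)
  qed (use choices z in auto)
qed (use assms in auto)

lemma count_in_winning_shift_iff:
  assumes "finite A" and "range x \<subseteq> A" and "length ns = d"
  shows "count (mset ns) \<in> winning_shift A (subshift_gen A x) \<longleftrightarrow>
    (\<exists>p :: nat \<Rightarrow> nat. \<forall>a\<in>{..<2 ^ d}. \<forall>m\<in>set ns. count (mset ns) m
      < card (continuations ((\<lambda>c. suffix (p c) x) ` {..<2 ^ d}) (x [p a \<rightarrow> p a + m])))"
    (is "_ \<longleftrightarrow> (\<exists>p. ?choices p)")
proof
  assume win: "count (mset ns) \<in> winning_shift A (subshift_gen A x)"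
  obtain n where n: "\<forall>m\<in>set ns. m < n"
    using finite_nat_set_iff_bounded by blast
  obtain S where S: "finite S" "S \<noteq> {}" "card S \<le> 2 ^ (\<Sum>j<n. count (mset ns) j)"
    and choices: "\<And>q m. q \<in> S \<Longrightarrow> m < n \<Longrightarrow>
      card (continuations ((\<lambda>q. suffix q x) ` S) (x [q \<rightarrow> q + m])) = count (mset ns) m + 1"
    using win by (rule winning_shift_imp_positions[where n = n]) blast
  have "(\<Sum>j<n. count (mset ns) j) = (\<Sum>j\<in>set ns. count (mset ns) j)"
    using n by (intro sum.mono_neutral_right) (auto simp: count_eq_zero_iff)
  also have "\<dots> = d"
    using size_multiset_overloaded_eq[of "mset ns"] assms(3) by simp
  finally have "card S \<le> card {..<2 ^ d :: nat}" using S(3) by simp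
  then obtain p :: "nat \<Rightarrow> nat" where p: "p ` {..<2 ^ d} = S"
    using card_le_inj[of S "{..<2 ^ d}"] inj_on_iff_surj[of S "{..<2 ^ d}"] S(1,2) by auto
  have "(\<lambda>c. suffix (p c) x) ` {..<2 ^ d} = (\<lambda>q. suffix q x) ` S"
    unfolding p[symmetric] by (simp add: image_image)
  then have "?choices p"
    using choices n p by auto
  then show "\<exists>p. ?choices p" by (rule exI[of ?choices])
next
  assume "\<exists>p. ?choices p"
  then obtain p where "?choices p" by (rule exE)
  then show "count (mset ns) \<in> winning_shift A (subshift_gen A x)"
    by (intro positions_imp_winning_shift[OF assms(1,2), of "p ` {..<2 ^ d}"])
      (auto simp: image_image count_eq_zero_iff lessThan_empty_iff)
qed

section \<open>Definability of winning\<close>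

lemma count_mset_map_upt: "count (mset (map e [0..<d])) m = card {l\<in>{..<d}. e l = m}"
proof -
  have "{l. l < d \<and> m = map e [0..<d] ! l} = {l\<in>{..<d}. e l = m}" by auto
  then show ?thesis unfolding count_mset count_list_eq_length_filter length_filter_conv_card by simp
qed

locale addable_coding =
  fixes r :: "nat \<Rightarrow> 'a list"
  assumes inj: "inj r"
    and finite_residuals_add: "finite_residuals (padded_tuples r {[a, b, a + b] | a b. True})"
begin

lemma finite_residuals_padded: "finite_residuals (padded r UNIV)"
proof -
  have "finite_residuals (padded r ((\<lambda>ns. ns ! 0) ` {[a, b, a + b] | a b. True}))"
    by (rule finite_residuals_padded_component[OF finite_residuals_add, of 3]) auto
  moreover have "(\<lambda>ns. ns ! 0) ` {[a, b, a + b] | a b. True} = (UNIV :: nat set)"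
  proof -
    have "n \<in> (\<lambda>ns. ns ! 0) ` {[a, b, a + b] | a b. True}" for n :: nat
      by (rule image_eqI[of _ _ "[n, 0, n + 0]"]) auto
    then show ?thesis by blast
  qed
  ultimately show ?thesis by simp
qed

lemma definable_add: "definable r (\<lambda>e. e k = e i + e j)"
proof -
  have "definable r (\<lambda>e. map e [0..<3] \<in> {[a, b, a + b] | a b. True})"
    using finite_residuals_add
    by (intro finite_residuals_imp_definable_tuple[OF inj]) auto
  then have "definable r (\<lambda>e :: nat \<Rightarrow> nat. e 2 = e 0 + e 1)"
    by (simp add: numeral_3_eq_3 numeral_2_eq_2)
  from definable_rename[OF this, of "\<lambda>v. if v = 0 then i else if v = 1 then j else k"]
  show ?thesis by simp
qed

lemma definable_le: "definable r (\<lambda>e. e i \<le> e j)"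
  using definable_ex[OF definable_add[of "Some j" "Some i" None] finite_residuals_padded]
  by (simp add: le_iff_add)

lemma definable_less: "definable r (\<lambda>e. e i < e j)"
  using definable_not[OF definable_le] by (simp add: not_le)

lemma definable_eq: "definable r (\<lambda>e. e i = e j)"
  using definable_conj[OF definable_le definable_le] by (simp add: eq_iff)

lemma definable_sorted: "definable r (\<lambda>e. sorted (map e [0..<d]))"
proof -
  have "definable r (\<lambda>e. \<forall>j\<in>{..<d}. \<forall>i\<in>{..<j}. e i \<le> e j)"
    by (intro definable_ball definable_le) simp_all
  moreover have "(\<forall>j\<in>{..<d}. \<forall>i\<in>{..<j}. e i \<le> e j) \<longleftrightarrow> sorted (map e [0..<d])" for e :: "nat \<Rightarrow> nat"
    by (auto simp: sorted_wrt_iff_nth_less)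
  ultimately show ?thesis by simp
qed

end

locale automatic_word = addable_coding r for r :: "nat \<Rightarrow> 'a list" +
  fixes A :: "'b set" and x :: "nat \<Rightarrow> 'b"
  assumes finite_alphabet: "finite A" and range_word: "range x \<subseteq> A"
    and finite_residuals_letter: "finite_residuals (padded r {n. x n = b})"
begin

lemma definable_letter: "definable r (\<lambda>e. x (e v) = b)"
  using definable_mem[OF inj finite_residuals_letter] by simp

lemma definable_letter_add: "definable r (\<lambda>e. x (e i + e j) = b)"
  using definable_ex[OF definable_conj[OF definable_add[of None "Some i" "Some j"]
      definable_letter[of None b]] finite_residuals_padded]
  by simp

lemma definable_factor_eq:
  "definable r (\<lambda>e. (x [e i \<rightarrow> e i + e k]) = (x [e j \<rightarrow> e j + e k]))"
proof -
  have "definable r (\<lambda>e. e None < e (Some k) \<and>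
      \<not> (\<exists>b\<in>A. x (e (Some j) + e None) = b \<and> x (e (Some i) + e None) = b))"
    by (intro definable_conj definable_less definable_not definable_bex finite_alphabet
        definable_letter_add)
  from definable_not[OF definable_ex[OF this finite_residuals_padded]]
  have "definable r (\<lambda>e. \<forall>l<e k. x (e i + l) = x (e j + l))"
    using range_word by (auto simp: image_subset_iff)
  then show ?thesis by (simp add: list_eq_iff_nth_eq)
qed

lemma definable_choice_card:
  fixes v p :: "nat \<Rightarrow> 'v"
  shows "definable r (\<lambda>e. card {l\<in>{..<d}. e (v l) = e k}
    < card (continuations ((\<lambda>c. suffix (e (p c)) x) ` {..<M}) (x [e i \<rightarrow> e i + e k])))"
proof -
  let ?continues = "\<lambda>b e. \<exists>c\<in>{..<M}.
    (x [e (p c) \<rightarrow> e (p c) + e k]) = (x [e i \<rightarrow> e i + e k]) \<and> x (e (p c) + e k) = b"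
  have "definable r (\<lambda>e. card {l\<in>{..<d}. e (v l) = e k} < card {b\<in>A. ?continues b e})"
    by (intro definable_card_less finite_alphabet definable_eq definable_bex definable_conj
        definable_factor_eq definable_letter_add finite_lessThan)
  moreover have "{b\<in>A. ?continues b e}
      = continuations ((\<lambda>c. suffix (e (p c)) x) ` {..<M}) (x [e i \<rightarrow> e i + e k])" for e
    using range_word by (auto simp: mem_continuations_iff image_subset_iff)
  ultimately show ?thesis by simp
qed

lemma definable_winning:
  "definable r (\<lambda>e. count (mset (map e [0..<d])) \<in> winning_shift A (subshift_gen A x))"
proof -
  define choices :: "(nat + nat \<Rightarrow> nat) \<Rightarrow> bool" where
    "choices e \<longleftrightarrow> (\<forall>a\<in>{..<2 ^ d}. \<forall>j\<in>{..<d}. card {l\<in>{..<d}. e (Inl l) = e (Inl j)}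
      < card (continuations ((\<lambda>c. suffix (e (Inr c)) x) ` {..<2 ^ d})
          (x [e (Inr a) \<rightarrow> e (Inr a) + e (Inl j)])))" for e
  have "definable r (\<lambda>e. \<exists>p. choices (case_sum e p))"
  proof (rule definable_ex_family)
    show "finite {..<2 ^ d :: nat}" by (rule finite_lessThan)
    show "definable r choices"
      unfolding choices_def by (intro definable_ball definable_choice_card finite_lessThan)
    show "choices (case_sum e p) \<longleftrightarrow> choices (case_sum e q)"
      if "\<And>c. c \<in> {..<2 ^ d} \<Longrightarrow> p c = q c" for e p q
    proof -
      have "(\<lambda>c. suffix (p c) x) ` {..<2 ^ d} = (\<lambda>c. suffix (q c) x) ` {..<2 ^ d}"
        using that by (intro image_cong) auto
      then show ?thesis using that by (simp add: choices_def)
    qed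
  qed (rule finite_residuals_padded)
  moreover have "(\<exists>p. choices (case_sum e p))
      \<longleftrightarrow> count (mset (map e [0..<d])) \<in> winning_shift A (subshift_gen A x)" for e
    unfolding count_in_winning_shift_iff[OF finite_alphabet range_word length_map, of e "[0..<d]"]
      count_mset_map_upt
    by (simp add: choices_def atLeast0LessThan)
  ultimately show ?thesis by simp
qed

end

section \<open>Abstract numeration systems\<close>

lemma ANS_bij_betw_rank:
  assumes "ANS \<Sigma> L prec"
  shows "bij_betw (\<lambda>w. card {v\<in>L. prec v w}) L UNIV"
proof -
  define rank where "rank w = card {v\<in>L. prec v w}" for w
  have irrefl: "\<And>u. u \<in> L \<Longrightarrow> \<not> prec u u"
    and trans: "\<And>u v w. \<lbrakk>u \<in> L; v \<in> L; w \<in> L; prec u v; prec v w\<rbrakk> \<Longrightarrow> prec u w"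
    and total: "\<And>u v. \<lbrakk>u \<in> L; v \<in> L; u \<noteq> v\<rbrakk> \<Longrightarrow> prec u v \<or> prec v u"
    and finite_below: "\<And>w. w \<in> L \<Longrightarrow> finite {v\<in>L. prec v w}" and infinite: "infinite L"
    using assms unfolding ANS_def by blast+
  have rank_less: "rank u < rank v" if "u \<in> L" "v \<in> L" "prec u v" for u v
    unfolding rank_def
  proof (rule psubset_card_mono[OF finite_below[OF that(2)]])
    show "{w \<in> L. prec w u} \<subset> {w \<in> L. prec w v}"
      using that irrefl trans by blast
  qed
  have inj: "inj_on rank L"
    by (rule inj_onI) (metis less_irrefl rank_less total)
  have "n \<in> rank ` L" for n
  proof -
    have "infinite (rank ` L)" using infinite inj by (simp add: finite_image_iff)
    then obtain w where w: "w \<in> L" "n < rank w"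
      by (auto simp: infinite_nat_iff_unbounded)
    have "rank ` {v\<in>L. prec v w} = {..<rank w}"
    proof (rule card_subset_eq)
      show "rank ` {v\<in>L. prec v w} \<subseteq> {..<rank w}" using rank_less w by auto
      have "inj_on rank {v\<in>L. prec v w}" using inj by (rule inj_on_subset) auto
      then show "card (rank ` {v\<in>L. prec v w}) = card {..<rank w}"
        by (simp add: card_image) (simp add: rank_def)
    qed simp
    then show ?thesis using w(2) by blast
  qed
  with inj have "bij_betw rank L UNIV" by (auto simp: bij_betw_def)
  then show ?thesis unfolding rank_def .
qed

lemma ANS_bij_betw_rep:
  assumes "ANS \<Sigma> L prec"
  shows "bij_betw (rep L prec) UNIV L"
proof -
  have "rep L prec = the_inv_into L (\<lambda>w. card {v\<in>L. prec v w})"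
    by (simp add: rep_def the_inv_into_def fun_eq_iff)
  then show ?thesis
    using bij_betw_the_inv_into[OF ANS_bij_betw_rank[OF assms]] by simp
qed

lemma ANS_rep_in_lists:
  assumes "ANS \<Sigma> L prec"
  shows "range (rep L prec) \<subseteq> lists \<Sigma>"
  using bij_betw_imp_surj_on[OF ANS_bij_betw_rep[OF assms]] assms by (simp add: ANS_def)

lemma addable_coding_rep:
  assumes "inj (rep L prec)" and "range (rep L prec) \<subseteq> lists \<Sigma>" and "addable \<Sigma> L prec"
  shows "addable_coding (rep L prec)"
proof
  show "finite_residuals (padded_tuples (rep L prec) {[a, b, a + b] | a b. True})"
    using assms(3) unfolding addable_def
    by (subst (asm) recognizable_iff_padded_tuples[OF assms(2)]) auto
qed (rule assms(1))

lemma automatic_word_rep: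
  assumes "ANS \<Sigma> L prec" and "addable \<Sigma> L prec" and "automatic \<Sigma> L prec x"
    and "finite A" and "range x \<subseteq> A"
  shows "automatic_word (rep L prec) A x"
proof -
  interpret addable_coding "rep L prec"
    using assms(1,2)
    by (intro addable_coding_rep bij_betw_imp_inj_on[OF ANS_bij_betw_rep] ANS_rep_in_lists)
  obtain Q :: "nat set" and q0 \<delta> \<tau> where Q: "finite Q" "q0 \<in> Q" "\<forall>q\<in>Q. \<forall>a\<in>\<Sigma>. \<delta> q a \<in> Q"
    and x: "\<And>n. x n = \<tau> (foldl \<delta> q0 (rep L prec n))"
    using assms(3) unfolding automatic_def by blast
  have "finite_residuals (padded (rep L prec) {n. x n = b})" for b
  proof -
    have "rep L prec n \<in> lists \<Sigma>" for n
      using ANS_rep_in_lists[OF assms(1)] by blast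
    then have "rep L prec -` {w \<in> lists \<Sigma>. \<tau> (foldl \<delta> q0 w) = b} = {n. x n = b}"
      unfolding x by blast
    then show ?thesis
      using finite_residuals_padded_vimage[OF finite_residuals_automaton[OF Q, of "\<lambda>q. \<tau> q = b"]
          finite_residuals_padded] by simp
  qed
  with assms(4,5) show ?thesis by unfold_locales
qed

section \<open>Codability\<close>

lemma nu_count_mset: "sorted ns \<Longrightarrow> nu (count (mset ns)) = ns"
  unfolding nu_def
  by (rule the_equality) (simp, metis multiset_eq_iff properties_for_sort)

lemma seq_sum_count_mset: "seq_sum (count (mset ns)) = enat (length ns)"
proof -
  have "{j. count (mset ns) j \<noteq> 0} = set ns" by (auto simp: count_eq_zero_iff)
  then show ?thesis using size_multiset_overloaded_eq[of "mset ns"] by (simp add: seq_sum_def)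
qed

lemma seq_sum_finiteE:
  assumes "seq_sum y \<noteq> \<infinity>"
  obtains ns where "sorted ns" and "y = count (mset ns)"
proof -
  have "finite {j. y j > 0}" using assms by (auto simp: seq_sum_def split: if_splits)
  then have "count (Abs_multiset y) = y" by (simp add: Abs_multiset_inverse)
  then have "y = count (mset (sorted_list_of_multiset (Abs_multiset y)))" by simp
  then show thesis using that sorted_sorted_list_of_multiset by blast
qed

lemma nu_image_Int_length:
  assumes "i \<le> k"
  shows "{nu y | y. y \<in> Y \<and> seq_sum y \<le> enat k} \<inter> {ns. length ns = i}
    = {ns. length ns = i \<and> sorted ns \<and> count (mset ns) \<in> Y}"
proof (intro equalityI subsetI)
  fix ns assume "ns \<in> {nu y | y. y \<in> Y \<and> seq_sum y \<le> enat k} \<inter> {ns. length ns = i}"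
  then obtain y where y: "y \<in> Y" "seq_sum y \<le> enat k" "ns = nu y" "length ns = i" by auto
  then have "seq_sum y \<noteq> \<infinity>" by (cases "seq_sum y") auto
  then obtain ns' where "sorted ns'" "y = count (mset ns')" by (rule seq_sum_finiteE)
  with y show "ns \<in> {ns. length ns = i \<and> sorted ns \<and> count (mset ns) \<in> Y}"
    by (simp add: nu_count_mset)
next
  fix ns assume "ns \<in> {ns. length ns = i \<and> sorted ns \<and> count (mset ns) \<in> Y}"
  then have "length ns = i" "ns = nu (count (mset ns))" "count (mset ns) \<in> Y"
    "seq_sum (count (mset ns)) \<le> enat k"
    using assms by (simp_all add: nu_count_mset seq_sum_count_mset)
  then show "ns \<in> {nu y | y. y \<in> Y \<and> seq_sum y \<le> enat k} \<inter> {ns. length ns = i}" by blast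
qed

lemma weakly_codable_iff:
  "weakly_codable \<Sigma> L prec Y \<longleftrightarrow>
    (\<forall>d. recognizable \<Sigma> L prec d {ns. length ns = d \<and> sorted ns \<and> count (mset ns) \<in> Y})"
  unfolding weakly_codable_def by (auto simp: nu_image_Int_length)

theorem mainTheorem3:
  fixes \<Sigma> :: "'a set" and L :: "'a list set" and prec :: "'a list \<Rightarrow> 'a list \<Rightarrow> bool"
    and A :: "'b set" and x :: "nat \<Rightarrow> 'b"
  assumes "ANS \<Sigma> L prec"
    and "addable \<Sigma> L prec"
    and "finite A" and "\<forall>n. x n \<in> A"
    and "automatic \<Sigma> L prec x"
  shows "weakly_codable \<Sigma> L prec (winning_shift A (subshift_gen A x))"
  unfolding weakly_codable_iff
proof
  fix d
  let ?Y = "{ns. length ns = d \<and> sorted ns \<and> count (mset ns) \<in> winning_shift A (subshift_gen A x)}"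
  interpret automatic_word "rep L prec" A x
    using assms by (intro automatic_word_rep) auto
  have Y: "?Y \<subseteq> {ns. length ns = d}" by blast
  have "definable (rep L prec) (\<lambda>e. map e [0..<d] \<in> ?Y)"
    using definable_conj[OF definable_sorted definable_winning] by simp
  with Y have "finite_residuals (padded_tuples (rep L prec) ?Y)"
    by (rule definable_tuple_imp_finite_residuals[OF inj _ finite_residuals_padded])
  then show "recognizable \<Sigma> L prec d ?Y"
    using recognizable_iff_padded_tuples[OF ANS_rep_in_lists[OF assms(1)] Y] by simp
qed

end
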